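(* Let $\mathcal{R}$ be a commutative ring containing $\mathbb{Q}$ and let $\phi(x)=\sum_{k\ge 0}\phi[k]\frac{x^k}{k!}\in\mathcal{R}[[x]]$ with $\phi[0]\neq 0$. Let $P_\phi(t,q)=\sum_{n\ge 1}p_n^{\phi}(q)\frac{t^n}{n!}$ be the exponential generating function of $\phi$-enriched increasing rooted trees enumerated with respect to path length, where $$p_n^{\phi}(q)=\sum_{T} q^{\mathrm{pl}(T)}\prod_{v\in[n]}\phi\big[\,|T^{-1}(v)|\,\big],$$ the sum being over all increasing rooted trees $T$ with vertex set $[n]$. Then $P_\phi$ satisfies $$\frac{\partial P_\phi(t,q)}{\partial t}=\phi\big(P_\phi(tq,q)\big),\qquad P_\phi(0,q)=0 .$$
   Context: $[n]=\{1,\dots,n\}$. An increasing rooted tree on $[n]$ is a (non-plane) labelled rooted tree with vertex set $[n]$ whose labels increase along every path from the root to the leaves. $T^{-1}(v)$ denotes the (possibly empty) set of children of the vertex $v$ (edges are oriented towards the root). The height of a vertex is the number of edges on the path from it to the root, and the path length $\mathrm{pl}(T)$ is the sum of the heights of all vertices of $T$. $P_\phi(t,q)$ is regarded as an element of $\mathcal{R}[q][[t]]$. *)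

theory Defs
  imports
    "HOL-Computational_Algebra.Polynomial"
    "HOL-Computational_Algebra.Formal_Power_Series"
    "Graph_Theory.Pair_Digraph"
begin

(* A rooted tree is a digraph T whose arcs run from child to parent, together with its root r.
   Uniqueness is required among all directed walks, repeated vertices allowed; this is what rules
   out directed cycles (including any arc leaving r).  The library predicate "tree" does not fit:
   it only forbids directed cycles, so it accepts orientations of undirected cycles. *)
definition rooted_tree :: "'a pair_pre_digraph \<Rightarrow> 'a \<Rightarrow> bool" where
  "rooted_tree T r \<longleftrightarrow>
     pair_wf_digraph T \<and> r \<in> pverts T \<and>
     (\<forall>v\<in>pverts T. \<exists>!p. pre_digraph.awalk (with_proj T) v p r)"

definition root_path :: "'a pair_pre_digraph \<Rightarrow> 'a \<Rightarrow> 'a \<Rightarrow> ('a \<times> 'a) list" where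
  "root_path T r v = (THE p. pre_digraph.awalk (with_proj T) v p r)"

definition children :: "'a pair_pre_digraph \<Rightarrow> 'a \<Rightarrow> 'a set" where
  "children T v = {u. (u, v) \<in> parcs T}"

definition height :: "'a pair_pre_digraph \<Rightarrow> 'a \<Rightarrow> 'a \<Rightarrow> nat" where
  "height T r v = length (root_path T r v)"

definition path_length :: "'a pair_pre_digraph \<Rightarrow> 'a \<Rightarrow> nat" where
  "path_length T r = (\<Sum>v\<in>pverts T. height T r v)"

(* root_path runs from a leaf up to the root, hence the labels decrease along it. *)
definition increasing_rooted_trees :: "nat \<Rightarrow> (nat pair_pre_digraph \<times> nat) set" where
  "increasing_rooted_trees n =
     {(T, r). rooted_tree T r \<and> pverts T = {1..n} \<and>
        (\<forall>v\<in>pverts T. children T v = {} \<longrightarrow>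
           sorted_wrt (>) (pawalk_verts v (root_path T r v)))}"

lemma finite_increasing_rooted_trees: "finite (increasing_rooted_trees n)"
proof (rule finite_subset)
  show "increasing_rooted_trees n \<subseteq>
      (\<lambda>E. \<lparr>pverts = {1..n}, parcs = E\<rparr>) ` Pow ({1..n} \<times> {1..n}) \<times> {1..n}"
  proof (clarsimp simp: increasing_rooted_trees_def rooted_tree_def)
    fix T :: "nat pair_pre_digraph"
    assume wf: "pair_wf_digraph T" and V: "pverts T = {Suc 0..n}"
    have "parcs T \<subseteq> {Suc 0..n} \<times> {Suc 0..n}"
      using pair_wf_digraph.in_arcsD1[OF wf] pair_wf_digraph.in_arcsD2[OF wf]
      unfolding V by fastforce
    then show "T \<in> (\<lambda>E. \<lparr>pverts = {Suc 0..n}, parcs = E\<rparr>) ` Pow ({Suc 0..n} \<times> {Suc 0..n})"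
      using V by (intro image_eqI[of _ _ "parcs T"]) auto
  qed
qed simp

definition tree_polynomial :: "(nat \<Rightarrow> 'a::comm_ring_1) \<Rightarrow> nat \<Rightarrow> 'a poly" where
  "tree_polynomial \<phi> n =
     (\<Sum>(T, r)\<in>increasing_rooted_trees n.
        monom (\<Prod>v\<in>{1..n}. \<phi> (card (children T v))) (path_length T r))"

(* A ring contains the rationals by way of a unital embedding, which is unique if it exists. *)
definition rat_embedding :: "(rat \<Rightarrow> 'a::comm_ring_1) \<Rightarrow> bool" where
  "rat_embedding \<iota> \<longleftrightarrow> inj \<iota> \<and> \<iota> 1 = 1 \<and>
     (\<forall>x y. \<iota> (x + y) = \<iota> x + \<iota> y) \<and> (\<forall>x y. \<iota> (x * y) = \<iota> x * \<iota> y)"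

definition egf :: "(rat \<Rightarrow> 'a::comm_ring_1) \<Rightarrow> (nat \<Rightarrow> 'a) \<Rightarrow> 'a fps" where
  "egf \<iota> a = Abs_fps (\<lambda>n. \<iota> (1 / fact n) * a n)"

(* The variable of the power series is t, that of the polynomial coefficients is q. *)
definition tree_egf :: "(rat \<Rightarrow> 'a::comm_ring_1) \<Rightarrow> (nat \<Rightarrow> 'a) \<Rightarrow> 'a poly fps" where
  "tree_egf \<iota> \<phi> =
     egf (\<lambda>x. [:\<iota> x:]) (\<lambda>n. if n = 0 then 0 else tree_polynomial \<phi> n)"

definition fps_const_poly :: "'a::comm_ring_1 fps \<Rightarrow> 'a poly fps" where
  "fps_const_poly f = Abs_fps (\<lambda>n. [:fps_nth f n:])"

end

(* An increasing rooted tree on {1..n} is a parent function f with f v < v for all v except the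
   root 1.  More generally let F n k be the generating polynomial of increasing forests on {1..n}
   with k roots, where every depth is one more than the height, so that F n 1 = q^n p_n.
   Deleting the root of a tree gives F (n+1) 1 = q^(n+1) sum_k phi k * F n k.  Splitting off the
   component of the least vertex gives G_(k+1)' = G_1' G_k for the exponential generating
   functions G_k of F _ k, hence G_k = G_1^k / k!.  As G_1 = P(tq, q), cancelling q^(n+1) in the
   first recurrence yields the differential equation. *)
theory Submission
  imports Defs
begin

text \<open>Splitting off a component leaves forests on arbitrary label sets, so the sums are
  defined for every vertex set \<open>S\<close>. That they depend on \<open>card S\<close> alone is
  not proved by relabelling: the two recurrences express a sum through sums over smaller sets, and
  independence of the labels follows by induction on the cardinality. Depth instead of height is
  what matches P(tq, q): each vertex contributes one extra factor q, and deleting the root of a tree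
  lowers every remaining depth by one, so the forest left behind is counted by the same statistic.
  The least vertex is chosen because it is a root of every increasing forest; it marks one component
  without any division by the number of roots. The ring may have zero divisors, so each cancellation
  needs its own reason: positive integers are cancelled through the embedding of the rationals,
  powers of q by comparing coefficients. The identity for G_k is used as G_1^k = k! G_k, and this k!
  meets the 1/k! in the series of \<open>\<phi>\<close>.\<close>

unbundle fps_syntax

section \<open>Increasing forests as parent functions\<close>

text \<open>A vertex v of the forest is a root iff f v = 0; depths are counted from the virtual
  parent 0, so roots have depth 1.\<close>

definition forests :: "nat set \<Rightarrow> nat \<Rightarrow> (nat \<Rightarrow> nat) set" where
  "forests S k = {f. (\<forall>v. v \<notin> S \<longrightarrow> f v = 0) \<and> (\<forall>v\<in>S. f v < v \<and> f v \<in> insert 0 S) \<and>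
     card {v \<in> S. f v = 0} = k}"

text \<open>The guard \<open>f v < v\<close> makes the recursion terminate for every function
  \<open>f\<close>. On a forest it holds at each vertex, so there the recursion stops only at the
  virtual parent 0.\<close>

function depth :: "(nat \<Rightarrow> nat) \<Rightarrow> nat \<Rightarrow> nat" where
  "depth f v = (if f v < v then Suc (depth f (f v)) else 0)"
  by auto
termination by (relation "measure snd") auto

declare depth.simps [simp del]

text \<open>The virtual parent 0 contributes no factor: the number of roots is weighted only once
  they become the children of a common vertex.\<close>

definition forest_weight :: "(nat \<Rightarrow> 'a::comm_ring_1) \<Rightarrow> nat set \<Rightarrow> (nat \<Rightarrow> nat) \<Rightarrow> 'a poly" where
  "forest_weight \<phi> S f = monom (\<Prod>v\<in>S. \<phi> (card {u \<in> S. f u = v})) (\<Sum>v\<in>S. depth f v)"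

definition forest_sum :: "(nat \<Rightarrow> 'a::comm_ring_1) \<Rightarrow> nat set \<Rightarrow> nat \<Rightarrow> 'a poly" where
  "forest_sum \<phi> S k = (\<Sum>f\<in>forests S k. forest_weight \<phi> S f)"

text \<open>The default value 0 is the one that \<open>forests\<close> prescribes outside the vertex
  set. It makes the representing function of a forest unique, so restricting and gluing are exact
  inverses.\<close>

definition restr :: "nat set \<Rightarrow> (nat \<Rightarrow> nat) \<Rightarrow> nat \<Rightarrow> nat" where
  "restr B f v = (if v \<in> B then f v else 0)"

definition glue :: "nat set \<Rightarrow> (nat \<Rightarrow> nat) \<Rightarrow> (nat \<Rightarrow> nat) \<Rightarrow> nat \<Rightarrow> nat" where
  "glue B f g v = (if v \<in> B then f v else g v)"

definition component :: "nat set \<Rightarrow> nat \<Rightarrow> (nat \<Rightarrow> nat) \<Rightarrow> nat set" where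
  "component S m f = {v \<in> S. \<exists>n. (f ^^ n) v = m}"

lemma depth_0 [simp]: "depth f 0 = 0"
  by (simp add: depth.simps)

lemma depth_Suc: "f v < v \<Longrightarrow> depth f v = Suc (depth f (f v))"
  by (subst depth.simps) simp

lemma finite_forests [simp]:
  assumes "finite S"
  shows "finite (forests S k)"
proof (rule finite_subset)
  show "forests S k \<subseteq> {f. \<forall>v. (v \<in> S \<longrightarrow> f v \<in> insert 0 S) \<and> (v \<notin> S \<longrightarrow> f v = 0)}"
    by (auto simp: forests_def)
  show "finite {f. \<forall>v. (v \<in> S \<longrightarrow> f v \<in> insert 0 S) \<and> (v \<notin> S \<longrightarrow> f v = (0::nat))}"
    using assms by (intro finite_set_of_finite_funs) auto
qed

lemma zero_notin_forests: "f \<in> forests S k \<Longrightarrow> 0 \<notin> S"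
  by (auto simp: forests_def)

text \<open>The parent of the least vertex is smaller than every vertex, hence 0. The least vertex
  is therefore always a root, and the only one if a single root is allowed.\<close>

lemma forests_Suc_0D:
  assumes "f \<in> forests B (Suc 0)" and "finite B" and "m \<in> B" and "\<forall>v\<in>B. m \<le> v"
  shows "f v = 0 \<longleftrightarrow> v \<notin> B \<or> v = m"
proof -
  have "f m < m" "f m \<in> insert 0 B"
    using assms by (auto simp: forests_def)
  then have "f m = 0"
    using assms(4) by fastforce
  then have "m \<in> {v \<in> B. f v = 0}"
    using assms(3) by simp
  moreover have "card {v \<in> B. f v = 0} = Suc 0"
    using assms(1) by (simp add: forests_def)
  ultimately have "{v \<in> B. f v = 0} = {m}"
    by (metis card_1_singletonE One_nat_def singletonD)
  moreover have "v \<notin> B \<longrightarrow> f v = 0"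
    using assms(1) by (simp add: forests_def)
  ultimately show ?thesis
    by (metis (mono_tags, lifting) mem_Collect_eq singleton_iff)
qed

section \<open>Decompositions of forests: splitting off a component, deleting the root\<close>

lemma depth_cong_closed:
  assumes "\<And>v. v \<in> B \<Longrightarrow> f v \<in> insert 0 B" and "\<And>v. v \<in> B \<Longrightarrow> g v = f v" and "v \<in> B"
  shows "depth g v = depth f v"
  using assms(3)
proof (induction v rule: less_induct)
  case (less v)
  then show ?case
    using assms(1)[of v] assms(2)[of v] by (auto simp: depth.simps[of _ v])
qed

lemma forest_weight_cong:
  assumes "\<And>v. v \<in> B \<Longrightarrow> f v \<in> insert 0 B" and "\<And>v. v \<in> B \<Longrightarrow> g v = f v"
  shows "forest_weight \<phi> B g = forest_weight \<phi> B f"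
proof -
  have "{u \<in> B. g u = v} = {u \<in> B. f u = v}" for v
    using assms by auto
  then show ?thesis
    using depth_cong_closed[OF assms] by (simp add: forest_weight_def)
qed

text \<open>No arc joins the two parts, since 0 is not a vertex. Hence all children of a vertex lie
  in its own part, and the depths simply add up.\<close>

lemma forest_weight_split:
  assumes "finite S" and "B \<subseteq> S" and "0 \<notin> S"
    and "\<And>v. v \<in> B \<Longrightarrow> f v \<in> insert 0 B" and "\<And>v. v \<in> S - B \<Longrightarrow> f v \<in> insert 0 (S - B)"
  shows "forest_weight \<phi> S f = forest_weight \<phi> B f * forest_weight \<phi> (S - B) f"
proof -
  have "{u \<in> S. f u = v} = {u \<in> B. f u = v}" if "v \<in> B" for v
    using assms that by (metis (mono_tags, lifting) Collect_cong Diff_iff insert_iff subset_iff)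
  moreover have "{u \<in> S. f u = v} = {u \<in> S - B. f u = v}" if "v \<in> S - B" for v
    using assms that by (metis (mono_tags, lifting) Collect_cong Diff_iff insert_iff subset_iff)
  ultimately have "(\<Prod>v\<in>S. \<phi> (card {u \<in> S. f u = v})) =
      (\<Prod>v\<in>B. \<phi> (card {u \<in> B. f u = v})) * (\<Prod>v\<in>S - B. \<phi> (card {u \<in> S - B. f u = v}))"
    using assms(1,2) by (simp add: prod.subset_diff[of B S] mult.commute)
  moreover have "(\<Sum>v\<in>S. depth f v) = (\<Sum>v\<in>B. depth f v) + (\<Sum>v\<in>S - B. depth f v)"
    using assms(1,2) by (simp add: sum.subset_diff[of B S])
  ultimately show ?thesis
    by (simp add: forest_weight_def mult_monom)
qed

text \<open>The iterates of \<open>f\<close> cannot reach \<open>m\<close> by way of 0, because 0 is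
  a fixed point different from \<open>m\<close>; so every vertex on the way to \<open>m\<close>
  stays in \<open>S\<close>.\<close>

lemma component_iff:
  assumes "f \<in> forests S k" and "m \<in> S"
  shows "v \<in> component S m f \<longleftrightarrow> v \<in> S \<and> (v = m \<or> f v \<in> component S m f)"
proof -
  have "0 \<notin> S" "f 0 = 0"
    using assms by (auto simp: forests_def)
  then have "(f ^^ n) 0 = 0" for n
    by (induction n) auto
  then have "(f ^^ n) 0 \<noteq> m" for n
    using assms(2) \<open>0 \<notin> S\<close> by metis
  then have *: "f v \<in> S" if "v \<in> S" "(f ^^ n) (f v) = m" for n
  proof -
    have "f v \<noteq> 0"
      using \<open>(f ^^ n) 0 \<noteq> m\<close> that(2) by metis
    then show ?thesis
      using assms(1) that(1) by (auto simp: forests_def)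
  qed
  have "(\<exists>n. (f ^^ n) v = m) \<longleftrightarrow> v = m \<or> (\<exists>n. (f ^^ n) (f v) = m)"
  proof
    assume "\<exists>n. (f ^^ n) v = m"
    then obtain n where "(f ^^ n) v = m" ..
    then show "v = m \<or> (\<exists>n. (f ^^ n) (f v) = m)"
      by (cases n) (auto simp del: funpow.simps simp: funpow_Suc_right)
  next
    assume "v = m \<or> (\<exists>n. (f ^^ n) (f v) = m)"
    then show "\<exists>n. (f ^^ n) v = m"
      by (metis funpow_0 funpow_Suc_right o_apply)
  qed
  then show ?thesis
    using * assms(2) by (auto simp: component_def)
qed

text \<open>Parents are smaller than their children, so the recursion in
  \<open>component_iff\<close> has only one solution. This recovers the first part from a glued
  forest.\<close>

lemma component_unique:
  assumes "f \<in> forests S k" and "m \<in> B" and "B \<subseteq> S"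
    and "\<And>v. v \<in> B \<Longrightarrow> v = m \<or> f v \<in> B" and "\<And>v. v \<in> S - B \<Longrightarrow> f v \<notin> B"
  shows "component S m f = B"
proof -
  have "v \<in> component S m f \<longleftrightarrow> v \<in> B" for v
  proof (induction v rule: less_induct)
    case (less v)
    show ?case
    proof (cases "v \<in> S")
      case True
      then have "f v < v"
        using assms(1) by (auto simp: forests_def)
      then show ?thesis
        using less.IH[of "f v"] component_iff[OF assms(1), of m v] assms(2-5) True by blast
    next
      case False
      then show ?thesis using assms(3) by (auto simp: component_def)
    qed
  qed
  then show ?thesis by blast
qed

lemma component_closed:
  assumes "f \<in> forests S k" and "m \<in> S" and "\<forall>v\<in>S. m \<le> v"
  shows "f m = 0"
    and "v \<in> component S m f \<Longrightarrow> v \<noteq> m \<Longrightarrow> f v \<in> component S m f"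
    and "v \<in> S - component S m f \<Longrightarrow> f v \<in> insert 0 (S - component S m f)"
proof -
  have "f m < m" "f m \<in> insert 0 S"
    using assms by (auto simp: forests_def)
  then show "f m = 0"
    using assms(3) by fastforce
  show "v \<in> component S m f \<Longrightarrow> v \<noteq> m \<Longrightarrow> f v \<in> component S m f"
    using component_iff[OF assms(1,2)] by blast
  assume v: "v \<in> S - component S m f"
  then have "f v \<in> insert 0 S"
    using assms(1) by (auto simp: forests_def)
  then show "f v \<in> insert 0 (S - component S m f)"
    using v component_iff[OF assms(1,2), of v] by auto
qed

lemma glue_forests:
  assumes "finite S" and "B \<subseteq> S" and "f \<in> forests B j" and "g \<in> forests (S - B) k"
  shows "glue B f g \<in> forests S (j + k)"
proof -
  have "{v \<in> S. glue B f g v = 0} = {v \<in> B. f v = 0} \<union> {v \<in> S - B. g v = 0}"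
    using assms(2) by (auto simp: glue_def)
  moreover have "card \<dots> = j + k"
    using assms by (subst card_Un_disjoint) (auto simp: forests_def finite_subset)
  ultimately have "card {v \<in> S. glue B f g v = 0} = j + k"
    by simp
  then show ?thesis
    using assms(2-4) by (auto simp: forests_def glue_def)
qed

text \<open>A forest corresponds to the component \<open>B\<close> of its least vertex, the tree on
  \<open>B\<close>, and the forest on the other vertices. Since \<open>m\<close> is a root of every
  forest, each forest arises exactly once.\<close>

lemma forest_sum_component:
  fixes \<phi> :: "nat \<Rightarrow> 'a::comm_ring_1"
  assumes S: "finite S" and m: "m \<in> S" "\<forall>v\<in>S. m \<le> v"
  shows "forest_sum \<phi> S (Suc k) =
    (\<Sum>B | m \<in> B \<and> B \<subseteq> S. forest_sum \<phi> B (Suc 0) * forest_sum \<phi> (S - B) k)"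
proof -
  let ?P = "SIGMA B:{B. m \<in> B \<and> B \<subseteq> S}. forests B (Suc 0) \<times> forests (S - B) k"
  let ?w = "\<lambda>(B, f, g). forest_weight \<phi> B f * forest_weight \<phi> (S - B) g"
  let ?C = "\<lambda>h. component S m h"
  have fin: "finite B" if "B \<subseteq> S" for B
    using S that by (rule rev_finite_subset)
  have "(\<Sum>B | m \<in> B \<and> B \<subseteq> S. forest_sum \<phi> B (Suc 0) * forest_sum \<phi> (S - B) k) =
      (\<Sum>B | m \<in> B \<and> B \<subseteq> S. \<Sum>(f, g)\<in>forests B (Suc 0) \<times> forests (S - B) k.
         forest_weight \<phi> B f * forest_weight \<phi> (S - B) g)"
    by (simp add: forest_sum_def sum_product sum.cartesian_product)
  also have "\<dots> = sum ?w ?P"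
  proof (subst sum.Sigma)
    show "finite {B. m \<in> B \<and> B \<subseteq> S}"
      by (rule finite_subset[of _ "Pow S"]) (use S in auto)
  qed (use S fin in auto)
  also have "\<dots> = (\<Sum>h\<in>forests S (Suc k). forest_weight \<phi> S h)"
  proof (rule sum.reindex_bij_witness[where
        j = "\<lambda>(B, f, g). glue B f g" and i = "\<lambda>h. (?C h, restr (?C h) h, restr (S - ?C h) h)"])
    fix p assume "p \<in> ?P"
    then obtain B f g where p: "p = (B, f, g)" and B: "m \<in> B" "B \<subseteq> S"
      and f: "f \<in> forests B (Suc 0)" and g: "g \<in> forests (S - B) k"
      by auto
    let ?h = "glue B f g"
    have h: "?h \<in> forests S (Suc k)"
      using glue_forests[OF S B(2) f g] by simp
    then show "(case p of (B, f, g) \<Rightarrow> glue B f g) \<in> forests S (Suc k)"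
      by (simp add: p)
    have "\<forall>v\<in>B. m \<le> v"
      using m(2) B(2) by auto
    then have root: "f v = 0 \<longleftrightarrow> v = m" if "v \<in> B" for v
      using forests_Suc_0D[OF f fin[OF B(2)] B(1)] that by simp
    have fB: "f v \<in> insert 0 B" if "v \<in> B" for v
      using f that by (auto simp: forests_def)
    have gB: "g v \<in> insert 0 (S - B)" if "v \<in> S - B" for v
      using g that by (auto simp: forests_def)
    have "0 \<notin> S"
      using zero_notin_forests[OF h] .
    have C: "?C ?h = B"
    proof (rule component_unique[OF h B])
      show "v = m \<or> ?h v \<in> B" if "v \<in> B" for v
        using root[OF that] fB[OF that] that by (auto simp: glue_def)
      show "?h v \<notin> B" if "v \<in> S - B" for v
        using gB[OF that] that \<open>0 \<notin> S\<close> B(2) by (auto simp: glue_def)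
    qed
    have "restr B ?h = f" "restr (S - B) ?h = g"
      using f g B(2) by (auto simp: restr_def glue_def forests_def fun_eq_iff)
    with C show "(\<lambda>h. (?C h, restr (?C h) h, restr (S - ?C h) h))
        (case p of (B, f, g) \<Rightarrow> glue B f g) = p"
      by (simp add: p)
    have "forest_weight \<phi> S ?h = forest_weight \<phi> B ?h * forest_weight \<phi> (S - B) ?h"
      using S B(2) \<open>0 \<notin> S\<close> fB gB by (intro forest_weight_split) (auto simp: glue_def)
    also have "forest_weight \<phi> B ?h = forest_weight \<phi> B f"
      using fB by (intro forest_weight_cong) (auto simp: glue_def)
    also have "forest_weight \<phi> (S - B) ?h = forest_weight \<phi> (S - B) g"
      using gB by (intro forest_weight_cong) (auto simp: glue_def)
    finally show "forest_weight \<phi> S (case p of (B, f, g) \<Rightarrow> glue B f g) = ?w p"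
      by (simp add: p)
  next
    fix h assume h: "h \<in> forests S (Suc k)"
    note cl = component_closed[OF h m]
    have B: "m \<in> ?C h" "?C h \<subseteq> S"
      using component_iff[OF h m(1), of m] m(1) by (auto simp: component_def)
    have "h v = 0" if "v \<notin> S" for v
      using h that by (auto simp: forests_def)
    then show "(case (?C h, restr (?C h) h, restr (S - ?C h) h) of (B, f, g) \<Rightarrow> glue B f g) = h"
      by (auto simp: restr_def glue_def fun_eq_iff)
    have "0 \<notin> S"
      using zero_notin_forests[OF h] .
    \<comment> \<open>Any vertex of the component other than \<open>m\<close> has its parent in the
      component, hence in \<open>S\<close>, which omits 0. So exactly one root is split off and
      \<open>k\<close> roots remain.\<close>
    have "h v = 0 \<longleftrightarrow> v = m" if "v \<in> ?C h" for v
      using cl(1) cl(2)[OF that] B(2) \<open>0 \<notin> S\<close> by (metis subsetD)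
    then have "{v \<in> ?C h. h v = 0} = {v \<in> ?C h. v = m}"
      by (rule Collect_cong[OF conj_cong[OF refl]])
    then have "{v \<in> ?C h. h v = 0} = {m}"
      using B(1) by auto
    moreover from this have "{v \<in> S - ?C h. h v = 0} = {v \<in> S. h v = 0} - {m}"
      using B by auto
    moreover have "card \<dots> = k"
      using h S cl(1) m(1) by (auto simp: forests_def)
    moreover have "{v \<in> A. restr A h v = 0} = {v \<in> A. h v = 0}" for A
      by (auto simp: restr_def)
    moreover have "restr A h v = 0" if "v \<notin> A" for A v
      using that by (simp add: restr_def)
    moreover have "h v < v" if "v \<in> S" for v
      using h that by (simp add: forests_def)
    then have "restr A h v < v" if "v \<in> A" "A \<subseteq> S" for A v
      using that by (auto simp: restr_def)
    moreover have "restr (?C h) h v \<in> insert 0 (?C h)" if "v \<in> ?C h" for v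
      using cl(1) cl(2)[OF that] that by (cases "v = m") (simp_all add: restr_def)
    moreover have "restr (S - ?C h) h v \<in> insert 0 (S - ?C h)" if "v \<in> S - ?C h" for v
      using cl(3)[OF that] that by (simp add: restr_def)
    ultimately have "restr (?C h) h \<in> forests (?C h) (Suc 0)"
      and "restr (S - ?C h) h \<in> forests (S - ?C h) k"
      using B(2) unfolding forests_def by (simp_all del: Diff_iff)
    then show "(?C h, restr (?C h) h, restr (S - ?C h) h) \<in> ?P"
      using B by simp
  qed
  finally show ?thesis
    by (simp add: forest_sum_def)
qed

text \<open>A tree arises from a forest on the other vertices by hanging its \<open>k\<close> roots
  below \<open>m\<close>. The new root has \<open>k\<close> children, which gives
  \<open>\<phi> k\<close>; it has depth 1 itself and raises each of the other depths by 1, which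
  gives the exponent \<open>card S\<close>.\<close>

lemma forest_sum_root:
  fixes \<phi> :: "nat \<Rightarrow> 'a::comm_ring_1"
  assumes S: "finite S" and m: "m \<in> S" "\<forall>v\<in>S. m \<le> v" and "0 \<notin> S"
  shows "forest_sum \<phi> S (Suc 0) =
    (\<Sum>k<card S. monom (\<phi> k) (card S) * forest_sum \<phi> (S - {m}) k)"
proof -
  let ?S = "S - {m}"
  let ?P = "SIGMA k:{..<card S}. forests ?S k"
  let ?up = "\<lambda>f v. if v \<in> ?S then (if f v = 0 then m else f v) else (0::nat)"
  let ?down = "\<lambda>g v. if g v = m then 0 else (g v::nat)"
  have "m \<noteq> 0"
    using m(1) \<open>0 \<notin> S\<close> by metis
  have lt: "m < v" if "v \<in> ?S" for v
    using m(2) that by (auto simp: le_less)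
  have "(\<Sum>k<card S. monom (\<phi> k) (card S) * forest_sum \<phi> ?S k) =
      (\<Sum>(k, f)\<in>?P. monom (\<phi> k) (card S) * forest_weight \<phi> ?S f)"
    using S by (simp add: forest_sum_def sum_distrib_left sum.Sigma)
  also have "\<dots> = (\<Sum>g\<in>forests S (Suc 0). forest_weight \<phi> S g)"
  proof (rule sum.reindex_bij_witness[where j = "\<lambda>(k, f). ?up f"
        and i = "\<lambda>g. (card {v \<in> ?S. g v = m}, ?down g)"])
    fix p assume "p \<in> ?P"
    then obtain k f where p: "p = (k, f)" and f: "f \<in> forests ?S k"
      by auto
    let ?g = "?up f"
    have fS: "f v < v" "f v \<in> insert 0 ?S" if "v \<in> ?S" for v
      using f that by (auto simp: forests_def)
    have f0: "f v = 0" if "v \<notin> ?S" for v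
      using f that by (auto simp: forests_def)
    \<comment> \<open>Before the roots are attached nothing hangs below \<open>m\<close>. Afterwards
      its children are exactly the former roots, so both \<open>k\<close> and \<open>f\<close> can
      be read off from \<open>?g\<close>.\<close>
    have fm: "f v \<noteq> m" for v
      using fS(2)[of v] f0[of v] \<open>m \<noteq> 0\<close> by (cases "v \<in> ?S") auto
    have "{v \<in> S. ?g v = 0} = {m}"
      using m(1) \<open>m \<noteq> 0\<close> by auto
    then have "card {v \<in> S. ?g v = 0} = Suc 0"
      by simp
    moreover have "?g v < v" "?g v \<in> insert 0 S" if "v \<in> S" for v
      using fS[of v] lt[of v] that \<open>m \<noteq> 0\<close> m(1) by auto
    ultimately show "(case p of (k, f) \<Rightarrow> ?up f) \<in> forests S (Suc 0)"
      unfolding p prod.case forests_def by simp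
    have roots: "{v \<in> ?S. ?g v = m} = {v \<in> ?S. f v = 0}"
      using fm by auto
    then have k: "card {v \<in> ?S. ?g v = m} = k"
      using f by (simp add: forests_def)
    moreover have "?down ?g = f"
      using f0 fm by (auto simp: fun_eq_iff)
    ultimately show "(\<lambda>g. (card {v \<in> ?S. g v = m}, ?down g)) (case p of (k, f) \<Rightarrow> ?up f) = p"
      by (simp only: p prod.case)
    have dm: "depth ?g m = Suc 0"
      using \<open>m \<noteq> 0\<close> by (simp add: depth.simps[of _ m])
    have d: "depth ?g v = Suc (depth f v)" if "v \<in> ?S" for v
      using that
    proof (induction v rule: less_induct)
      case (less v)
      have "?g v < v"
        using fS(1)[OF less.prems] lt[OF less.prems] less.prems by simp
      then have "depth ?g v = Suc (depth ?g (?g v))"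
        by (rule depth_Suc)
      moreover have "depth f v = Suc (depth f (f v))"
        using fS(1)[OF less.prems] by (rule depth_Suc)
      ultimately have gv: "depth ?g v = Suc (depth ?g (?g v))" "depth f v = Suc (depth f (f v))" .
      show ?case
      proof (cases "f v = 0")
        case True
        then have "?g v = m"
          using less.prems by simp
        with gv dm True show ?thesis
          by (simp only: depth_0)
      next
        case False
        then have "f v \<in> ?S" "?g v = f v"
          using fS(2)[OF less.prems] less.prems by auto
        with gv less.IH[of "f v"] fS(1)[OF less.prems] show ?thesis
          by (simp only:)
      qed
    qed
    have "(\<Sum>v\<in>S. depth ?g v) = depth ?g m + (\<Sum>v\<in>?S. depth ?g v)"
      using S m(1) by (rule sum.remove)
    also have "(\<Sum>v\<in>?S. depth ?g v) = (\<Sum>v\<in>?S. Suc (depth f v))"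
      using d by (rule sum.cong[OF refl])
    also have "\<dots> = card ?S + (\<Sum>v\<in>?S. depth f v)"
      by (simp only: sum_Suc add.commute)
    also have "depth ?g m + \<dots> = card S + (\<Sum>v\<in>?S. depth f v)"
      using dm card.remove[OF S m(1)] by linarith
    finally have D: "(\<Sum>v\<in>S. depth ?g v) = card S + (\<Sum>v\<in>?S. depth f v)" .
    have "{u \<in> S. ?g u = m} = {u \<in> ?S. ?g u = m}"
      using \<open>m \<noteq> 0\<close> by auto
    with k have "card {u \<in> S. ?g u = m} = k"
      by simp
    moreover have "{u \<in> S. ?g u = v} = {u \<in> ?S. f u = v}" if "v \<in> ?S" for v
      using that \<open>0 \<notin> S\<close> by auto
    ultimately have "(\<Prod>v\<in>S. \<phi> (card {u \<in> S. ?g u = v})) =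
        \<phi> k * (\<Prod>v\<in>?S. \<phi> (card {u \<in> ?S. f u = v}))"
      by (simp only: prod.remove[OF S m(1)] cong: prod.cong)
    with D show "forest_weight \<phi> S (case p of (k, f) \<Rightarrow> ?up f) =
        (case p of (k, f) \<Rightarrow> monom (\<phi> k) (card S) * forest_weight \<phi> ?S f)"
      by (simp add: p forest_weight_def mult_monom)
  next
    fix g assume g: "g \<in> forests S (Suc 0)"
    have gS: "g v < v" "g v \<in> insert 0 S" if "v \<in> S" for v
      using g that by (auto simp: forests_def)
    have g0: "g v = 0 \<longleftrightarrow> v \<notin> S \<or> v = m" for v
      using forests_Suc_0D[OF g S m] .
    then show "(case (card {v \<in> ?S. g v = m}, ?down g) of (k, f) \<Rightarrow> ?up f) = g"
      using \<open>m \<noteq> 0\<close> by (auto simp: fun_eq_iff)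
    have "{v \<in> ?S. ?down g v = 0} = {v \<in> ?S. g v = m}"
      using g0 by auto
    moreover have "?down g v < v" "?down g v \<in> insert 0 ?S" if "v \<in> ?S" for v
      using gS[of v] that by auto
    moreover have "?down g v = 0" if "v \<notin> ?S" for v
      using g0[of v] that by auto
    ultimately have "?down g \<in> forests ?S (card {v \<in> ?S. g v = m})"
      unfolding forests_def by simp
    moreover have "card {v \<in> ?S. g v = m} < card S"
      using S m(1) by (intro psubset_card_mono) auto
    ultimately show "(card {v \<in> ?S. g v = m}, ?down g) \<in> ?P"
      by simp
  qed
  finally show ?thesis
    by (simp add: forest_sum_def)
qed

lemma forests_empty: "forests {} k = (if k = 0 then {\<lambda>_. 0} else {})"
  by (auto simp: forests_def)

lemma forest_sum_empty: "forest_sum \<phi> {} k = (if k = 0 then 1 else 0)"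
  by (simp add: forest_sum_def forests_empty forest_weight_def one_pCons monom_0)

lemma forest_sum_no_root:
  assumes "finite S" and "S \<noteq> {}"
  shows "forest_sum \<phi> S 0 = 0"
proof -
  obtain m where m: "m \<in> S" "\<forall>v\<in>S. m \<le> v"
    using assms by (metis Min_in Min_le)
  have "f \<notin> forests S 0" for f
  proof
    assume f: "f \<in> forests S 0"
    then have "f m = 0"
      using component_closed(1) m by blast
    then have "m \<in> {v \<in> S. f v = 0}"
      using m(1) by simp
    then have "card {v \<in> S. f v = 0} \<noteq> 0"
      using assms(1) by (subst card_0_eq) auto
    then show False
      using f by (simp only: forests_def mem_Collect_eq simp_thms)
  qed
  then have "forests S 0 = {}"
    by blast
  then show ?thesis
    by (simp add: forest_sum_def)
qed

section \<open>Forest sums depend only on the number of vertices\<close>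

lemma sum_Pow_card:
  fixes f :: "nat \<Rightarrow> 'b::semiring_1"
  assumes "finite A"
  shows "(\<Sum>X\<in>Pow A. f (card X)) = (\<Sum>j\<le>card A. of_nat (card A choose j) * f j)"
proof -
  have "(\<Sum>X\<in>Pow A. f (card X)) = (\<Sum>j\<le>card A. \<Sum>X\<in>{X \<in> Pow A. card X = j}. f (card X))"
    using assms by (intro sum.group[symmetric]) (auto intro: card_mono)
  also have "\<dots> = (\<Sum>j\<le>card A. of_nat (card {X \<in> Pow A. card X = j}) * f j)"
    by (intro sum.cong) auto
  finally show ?thesis
    using n_subsets[OF assms] by simp
qed

text \<open>Independence of the labels is assumed only for \<open>n\<close> vertices. The lemma thus
  serves inside the induction that establishes independence, and afterwards as the recurrence
  itself.\<close>

lemma forest_sum_root_card: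
  fixes \<phi> :: "nat \<Rightarrow> 'a::comm_ring_1"
  assumes "\<And>T. finite T \<Longrightarrow> 0 \<notin> T \<Longrightarrow> card T = n \<Longrightarrow> forest_sum \<phi> T = h"
    and S: "finite S" "0 \<notin> S" "card S = Suc n"
  shows "forest_sum \<phi> S (Suc 0) = (\<Sum>k\<le>n. monom (\<phi> k) (Suc n) * h k)"
proof -
  have "Min S \<in> S"
    using S by (intro Min_in) auto
  then have "forest_sum \<phi> (S - {Min S}) = h"
    using S by (intro assms(1)) auto
  moreover have "\<forall>v\<in>S. Min S \<le> v"
    using S(1) by simp
  ultimately show ?thesis
    using forest_sum_root[OF S(1) \<open>Min S \<in> S\<close> _ S(2), of \<phi>] S(3)
    by (simp only: lessThan_Suc_atMost)
qed

text \<open>The assumption on single trees has to reach \<open>Suc n\<close>, one further than the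
  other: the component of the least vertex may be all of \<open>S\<close>. The binomial coefficient
  has upper index \<open>n\<close> because one vertex of the component is prescribed.\<close>

lemma forest_sum_component_card:
  fixes \<phi> :: "nat \<Rightarrow> 'a::comm_ring_1"
  assumes le: "\<And>T. finite T \<Longrightarrow> 0 \<notin> T \<Longrightarrow> card T \<le> n \<Longrightarrow> forest_sum \<phi> T k = h (card T) k"
    and one: "\<And>T. finite T \<Longrightarrow> 0 \<notin> T \<Longrightarrow> T \<noteq> {} \<Longrightarrow> card T \<le> Suc n \<Longrightarrow>
      forest_sum \<phi> T (Suc 0) = h (card T) (Suc 0)"
    and S: "finite S" "0 \<notin> S" "card S = Suc n"
  shows "forest_sum \<phi> S (Suc k) =
    (\<Sum>j\<le>n. of_nat (n choose j) * (h (Suc j) (Suc 0) * h (n - j) k))"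
proof -
  define m where "m = Min S"
  have m: "m \<in> S" "\<forall>v\<in>S. m \<le> v"
    unfolding m_def using S by (auto intro!: Min_in)
  have card: "finite (S - {m})" "card (S - {m}) = n"
    using S m(1) by auto
  have "forest_sum \<phi> S (Suc k) =
      (\<Sum>B | m \<in> B \<and> B \<subseteq> S. forest_sum \<phi> B (Suc 0) * forest_sum \<phi> (S - B) k)"
    by (rule forest_sum_component[OF S(1) m])
  also have "\<dots> = (\<Sum>X\<in>Pow (S - {m}). h (Suc (card X)) (Suc 0) * h (n - card X) k)"
  proof (rule sum.reindex_bij_witness[where i = "insert m" and j = "\<lambda>B. B - {m}"])
    fix B assume B: "B \<in> {B. m \<in> B \<and> B \<subseteq> S}"
    then have fin: "finite B"
      using S(1) finite_subset by blast
    have c: "card B = Suc (card (B - {m}))" "card B \<le> Suc n"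
      using B card.remove[OF fin, of m] card_mono[OF S(1), of B] S(3) by auto
    have d: "card (S - B) = n - card (B - {m})"
      using B S(3) fin c by (simp add: card_Diff_subset)
    have "forest_sum \<phi> B (Suc 0) = h (Suc (card (B - {m}))) (Suc 0)"
      using one[of B] B S(2) fin c by auto
    moreover have "forest_sum \<phi> (S - B) k = h (n - card (B - {m})) k"
      using le[of "S - B"] S d by auto
    ultimately show "h (Suc (card (B - {m}))) (Suc 0) * h (n - card (B - {m})) k =
        forest_sum \<phi> B (Suc 0) * forest_sum \<phi> (S - B) k"
      by simp
  qed (use m(1) in auto)
  also have "\<dots> = (\<Sum>j\<le>n. of_nat (n choose j) * (h (Suc j) (Suc 0) * h (n - j) k))"
    using sum_Pow_card[OF card(1), where f = "\<lambda>j. h (Suc j) (Suc 0) * h (n - j) k"]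
    by (simp add: card(2))
  finally show ?thesis .
qed

definition forest_poly :: "(nat \<Rightarrow> 'a::comm_ring_1) \<Rightarrow> nat \<Rightarrow> nat \<Rightarrow> 'a poly" where
  "forest_poly \<phi> n k = forest_sum \<phi> {1..n} k"

text \<open>Induction on a bound for the cardinality, in two stages at each size: single trees
  through deletion of the root, then more roots through splitting off a component, which already
  needs the trees of the same size.\<close>

lemma forest_sum_eq_forest_poly:
  fixes \<phi> :: "nat \<Rightarrow> 'a::comm_ring_1"
  assumes "finite S" and "0 \<notin> S"
  shows "forest_sum \<phi> S k = forest_poly \<phi> (card S) k"
proof -
  have "card S \<le> n \<Longrightarrow> forest_sum \<phi> S k = forest_poly \<phi> (card S) k" for n
    using assms
  proof (induction n arbitrary: S k)
    case 0
    then show ?case by (simp add: forest_poly_def)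
  next
    case (Suc n)
    show ?case
    proof (cases "card S = Suc n")
      case False
      then show ?thesis using Suc by simp
    next
      case True
      have one: "forest_sum \<phi> T (Suc 0) = forest_poly \<phi> (card T) (Suc 0)"
        if T: "finite T" "0 \<notin> T" "card T \<le> Suc n" for T
      proof (cases "card T = Suc n")
        case False
        then show ?thesis using Suc.IH T by simp
      next
        case True
        have IH: "forest_sum \<phi> U = forest_poly \<phi> n" if "finite U" "0 \<notin> U" "card U = n" for U
          using Suc.IH[of U] that by (simp add: fun_eq_iff)
        \<comment> \<open>The right-hand side does not mention \<open>U\<close>, so \<open>T\<close>
          and the standard set \<open>{1..Suc n}\<close> have the same sum.\<close>
        have "forest_sum \<phi> U (Suc 0) = (\<Sum>k\<le>n. monom (\<phi> k) (Suc n) * forest_poly \<phi> n k)"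
          if "finite U" "0 \<notin> U" "card U = Suc n" for U
          using IH that by (rule forest_sum_root_card)
        from this[of T] this[of "{1..Suc n}"] show ?thesis
          using T(1,2) True by (simp add: forest_poly_def del: sum.atMost_Suc)
      qed
      show ?thesis
      proof (cases k)
        case 0
        moreover have "S \<noteq> {}"
          using True by auto
        ultimately show ?thesis
          using True Suc.prems by (simp add: forest_poly_def forest_sum_no_root)
      next
        case (Suc j)
        have "forest_sum \<phi> U (Suc j) = (\<Sum>i\<le>n. of_nat (n choose i) *
            (forest_poly \<phi> (Suc i) (Suc 0) * forest_poly \<phi> (n - i) j))"
          if "finite U" "0 \<notin> U" "card U = Suc n" for U
          using Suc.IH one by (intro forest_sum_component_card that) simp_all
        from this[of S] this[of "{1..Suc n}"] show ?thesis
          using True Suc.prems \<open>k = Suc j\<close> by (simp add: forest_poly_def)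
      qed
    qed
  qed
  then show ?thesis by blast
qed

lemma forest_poly_0: "forest_poly \<phi> 0 k = (if k = 0 then 1 else 0)"
  by (simp add: forest_poly_def forest_sum_empty)

lemma forest_poly_no_root: "forest_poly \<phi> (Suc n) 0 = 0"
  by (simp add: forest_poly_def forest_sum_no_root)

lemma forest_poly_root:
  "forest_poly \<phi> (Suc n) (Suc 0) = (\<Sum>k\<le>n. monom (\<phi> k) (Suc n) * forest_poly \<phi> n k)"
proof -
  have "forest_sum \<phi> T = forest_poly \<phi> n" if "finite T" "0 \<notin> T" "card T = n" for T
    using forest_sum_eq_forest_poly that by blast
  from forest_sum_root_card[OF this, where S = "{1..Suc n}"] show ?thesis
    by (simp add: forest_poly_def)
qed

text \<open>The binomial convolution is the coefficient form of G_(k+1)' = G_1' G_k.\<close>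

lemma forest_poly_component:
  "forest_poly \<phi> (Suc n) (Suc k) =
    (\<Sum>j\<le>n. of_nat (n choose j) * (forest_poly \<phi> (Suc j) (Suc 0) * forest_poly \<phi> (n - j) k))"
  using forest_sum_component_card[of n \<phi> k "forest_poly \<phi>" "{1..Suc n}"]
  by (simp add: forest_sum_eq_forest_poly)

section \<open>Increasing trees\<close>

text \<open>Vertex 1 gets no arc: it is the root of every forest on \<open>{1..n}\<close> with one
  root, and its parent 0 is only virtual.\<close>

definition parent_digraph :: "nat \<Rightarrow> (nat \<Rightarrow> nat) \<Rightarrow> nat pair_pre_digraph" where
  "parent_digraph n f = \<lparr>pverts = {1..n}, parcs = (\<lambda>v. (v, f v)) ` {2..n}\<rparr>"

abbreviation walk :: "'a pair_pre_digraph \<Rightarrow> 'a \<Rightarrow> ('a \<times> 'a) list \<Rightarrow> 'a \<Rightarrow> bool" where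
  "walk T \<equiv> pre_digraph.awalk (with_proj T)"

lemma walk_Nil: "walk T u [] v \<longleftrightarrow> u = v \<and> u \<in> pverts T"
  by (auto simp: pre_digraph.awalk_def cas_with_proj_eq)

lemma walk_Cons:
  assumes "pair_wf_digraph T"
  shows "walk T u (e # p) v \<longleftrightarrow> e \<in> parcs T \<and> fst e = u \<and> walk T (snd e) p v"
  using pair_wf_digraph.in_arcsD1[OF assms] pair_wf_digraph.in_arcsD2[OF assms]
  by (cases e) (auto simp: pre_digraph.awalk_def cas_with_proj_eq)

lemma walk_append:
  assumes "pair_wf_digraph T" and "walk T u p v" and "walk T v q w"
  shows "walk T u (p @ q) w"
  using assms(2,3)
  by (induction p arbitrary: u) (auto simp: walk_Nil walk_Cons[OF assms(1)])

lemma walk_start: "walk T u p v \<Longrightarrow> u \<in> pverts T"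
  by (simp add: pre_digraph.awalk_def)

lemma pawalk_verts_append:
  "pawalk_verts w (p @ (u, v) # q) = map fst p @ u # pawalk_verts v q"
  by (induction p arbitrary: w) auto

lemma start_in_pawalk_verts: "walk T u p v \<Longrightarrow> u \<in> set (pawalk_verts u p)"
  by (cases p) (auto simp: pre_digraph.awalk_def cas_with_proj_eq)

lemma root_path_eqI:
  assumes "\<And>q. walk T v q r \<longleftrightarrow> q = p"
  shows "root_path T r v = p"
  using assms by (simp add: root_path_def)

lemma walk_root_path:
  assumes "rooted_tree T r" and "v \<in> pverts T"
  shows "walk T v (root_path T r v) r"
proof -
  have "\<exists>!p. walk T v p r"
    using assms by (simp add: rooted_tree_def)
  then show ?thesis
    unfolding root_path_def by (rule theI')
qed

lemma walk_to_root_unique: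
  assumes "rooted_tree T r" and "walk T v p r"
  shows "root_path T r v = p"
  using assms walk_start[OF assms(2)] walk_root_path[OF assms(1)]
  unfolding rooted_tree_def by blast

section \<open>From parent functions to increasing trees\<close>

context
  fixes n :: nat and f :: "nat \<Rightarrow> nat"
  assumes n: "n \<ge> 1" and f: "f \<in> forests {1..n} (Suc 0)"
begin

lemma parent_eq_0_iff: "f v = 0 \<longleftrightarrow> v \<notin> {2..n}"
proof -
  have "f v = 0 \<longleftrightarrow> v \<notin> {1..n} \<or> v = 1"
    by (rule forests_Suc_0D[OF f]) (use n in auto)
  moreover have "v \<notin> {1..n} \<or> v = 1 \<longleftrightarrow> v \<notin> {2..n}"
    by auto
  ultimately show ?thesis
    by simp
qed

lemma parent_less:
  assumes "v \<in> {2..n}"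
  shows "f v < v \<and> f v \<in> {1..n}"
proof -
  have "f v < v" "f v \<in> insert 0 {1..n}"
    using f assms by (simp_all add: forests_def)
  moreover have "f v \<noteq> 0"
    using parent_eq_0_iff assms by blast
  ultimately show ?thesis by blast
qed

lemma pair_wf_parent_digraph: "pair_wf_digraph (parent_digraph n f)"
  by unfold_locales (use parent_less in \<open>fastforce simp: parent_digraph_def\<close>)+

text \<open>The four claims share one induction along the parents. The upper bound on the vertices
  is there to strengthen it: \<open>v\<close> can be put in front of the sorted list because
  everything after it is at most \<open>f v\<close>.\<close>

lemma parent_digraph_walk:
  assumes "v \<in> {1..n}"
  shows "\<exists>p. (\<forall>q. walk (parent_digraph n f) v q 1 \<longleftrightarrow> q = p) \<and> Suc (length p) = depth f v \<and>
    sorted_wrt (>) (pawalk_verts v p) \<and> (\<forall>u\<in>set (pawalk_verts v p). u \<le> v)"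
  using assms
proof (induction v rule: less_induct)
  case (less v)
  note Cons = walk_Cons[OF pair_wf_parent_digraph]
  show ?case
  proof (cases "v = 1")
    case True
    have "walk (parent_digraph n f) v q 1 \<longleftrightarrow> q = []" for q
      using True n by (cases q) (auto simp: walk_Nil Cons, auto simp: parent_digraph_def)
    moreover have "depth f v = Suc 0"
      using True parent_eq_0_iff[of 1] by (simp add: depth_Suc)
    ultimately show ?thesis
      by (intro exI[of _ "[]"]) simp
  next
    case False
    then have v: "v \<in> {2..n}"
      using less.prems by auto
    then obtain p where p: "\<And>q. walk (parent_digraph n f) (f v) q 1 \<longleftrightarrow> q = p"
      and len: "Suc (length p) = depth f (f v)"
      and sorted: "sorted_wrt (>) (pawalk_verts (f v) p)"
      and le: "\<forall>u\<in>set (pawalk_verts (f v) p). u \<le> f v"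
      using less.IH[of "f v"] parent_less[OF v] by blast
    \<comment> \<open>The only arc leaving \<open>v\<close> is \<open>(v, f v)\<close>, so the first
      step of a walk is forced.\<close>
    have "walk (parent_digraph n f) v q 1 \<longleftrightarrow> q = (v, f v) # p" for q
    proof (cases q)
      case Nil
      then show ?thesis
        using False by (simp add: walk_Nil)
    next
      case (Cons e q')
      have "e \<in> parcs (parent_digraph n f) \<and> fst e = v \<longleftrightarrow> e = (v, f v)"
        using v by (auto simp: parent_digraph_def)
      then have "walk (parent_digraph n f) v q 1 \<longleftrightarrow>
          e = (v, f v) \<and> walk (parent_digraph n f) (snd e) q' 1"
        unfolding Cons walk_Cons[OF pair_wf_parent_digraph] by blast
      also have "\<dots> \<longleftrightarrow> e = (v, f v) \<and> q' = p"
        using p by (metis snd_conv)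
      finally show ?thesis
        by (simp add: Cons)
    qed
    moreover have "depth f v = Suc (depth f (f v))"
      using parent_less[OF v] by (simp add: depth_Suc)
    moreover have "\<forall>u\<in>set (pawalk_verts (f v) p). u < v"
      using le parent_less[OF v] by fastforce
    ultimately show ?thesis
      using len sorted by (intro exI[of _ "(v, f v) # p"]) auto
  qed
qed

lemma parent_digraph_root_path:
  assumes "v \<in> {1..n}"
  shows "\<exists>!p. walk (parent_digraph n f) v p 1"
    and "sorted_wrt (>) (pawalk_verts v (root_path (parent_digraph n f) 1 v))"
    and "Suc (height (parent_digraph n f) 1 v) = depth f v"
proof -
  obtain p where p: "\<And>q. walk (parent_digraph n f) v q 1 \<longleftrightarrow> q = p"
    and *: "Suc (length p) = depth f v" "sorted_wrt (>) (pawalk_verts v p)"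
    using parent_digraph_walk[OF assms] by blast
  then show "\<exists>!p. walk (parent_digraph n f) v p 1"
    by simp
  have "root_path (parent_digraph n f) 1 v = p"
    using p by (rule root_path_eqI)
  with * show "sorted_wrt (>) (pawalk_verts v (root_path (parent_digraph n f) 1 v))"
    and "Suc (height (parent_digraph n f) 1 v) = depth f v"
    by (simp_all add: height_def)
qed

lemma parent_digraph_increasing: "(parent_digraph n f, 1) \<in> increasing_rooted_trees n"
proof -
  have "pverts (parent_digraph n f) = {1..n}"
    by (simp add: parent_digraph_def)
  then show ?thesis
    using pair_wf_parent_digraph parent_digraph_root_path(1,2) n
    by (simp add: increasing_rooted_trees_def rooted_tree_def)
qed

lemma children_parent_digraph:
  assumes "v \<in> {1..n}"
  shows "children (parent_digraph n f) v = {u \<in> {1..n}. f u = v}"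
proof -
  have "u \<in> {1..n} \<and> f u = v \<longleftrightarrow> u \<in> {2..n} \<and> f u = v" for u
    using parent_eq_0_iff[of u] assms by auto
  then have "{u \<in> {1..n}. f u = v} = {u \<in> {2..n}. f u = v}"
    by blast
  then show ?thesis
    by (simp only: children_def parent_digraph_def pair_pre_digraph.simps) blast
qed

lemma path_length_parent_digraph:
  "(\<Sum>v\<in>{1..n}. depth f v) = n + path_length (parent_digraph n f) 1"
proof -
  have "(\<Sum>v\<in>{1..n}. depth f v) = (\<Sum>v\<in>{1..n}. Suc (height (parent_digraph n f) 1 v))"
    using parent_digraph_root_path(3) by (intro sum.cong) simp_all
  also have "\<dots> = n + path_length (parent_digraph n f) 1"
    by (simp add: sum_Suc path_length_def parent_digraph_def)
  finally show ?thesis .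
qed

text \<open>The factor \<open>monom 1 n\<close> collects the 1 by which depth exceeds height at each
  of the \<open>n\<close> vertices.\<close>

lemma forest_weight_parent_digraph:
  "forest_weight \<phi> {1..n} f =
    monom 1 n * monom (\<Prod>v\<in>{1..n}. \<phi> (card (children (parent_digraph n f) v)))
      (path_length (parent_digraph n f) 1)"
proof -
  have "(\<Prod>v\<in>{1..n}. \<phi> (card {u \<in> {1..n}. f u = v})) =
      (\<Prod>v\<in>{1..n}. \<phi> (card (children (parent_digraph n f) v)))"
    by (intro prod.cong) (simp_all only: children_parent_digraph)
  then show ?thesis
    by (simp only: forest_weight_def path_length_parent_digraph mult_monom mult_1)
qed

end

section \<open>From increasing trees back to parent functions\<close>

text \<open>Monotonicity is only given along paths that start at a leaf, so the arc has to be placed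
  on such a path: below \<open>u\<close> there is a leaf, and its root path runs through the
  arc.\<close>

lemma increasing_arc:
  assumes T: "(T, r) \<in> increasing_rooted_trees n" and uv: "(u, v) \<in> parcs T"
  shows "v < u"
proof -
  have tree: "rooted_tree T r" and wf: "pair_wf_digraph T" and V: "pverts T = {1..n}"
    and sorted: "\<And>v. v \<in> pverts T \<Longrightarrow> children T v = {} \<Longrightarrow>
      sorted_wrt (>) (pawalk_verts v (root_path T r v))"
    using T by (auto simp: increasing_rooted_trees_def rooted_tree_def)
  have u: "u \<in> pverts T" "v \<in> pverts T"
    using pair_wf_digraph.in_arcsD1[OF wf uv] pair_wf_digraph.in_arcsD2[OF wf uv] by auto
  \<comment> \<open>These are the descendants of \<open>u\<close>, including \<open>u\<close>. One
    of maximal height is a leaf, because a child of it would be a descendant of greater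
    height.\<close>
  let ?D = "{w \<in> pverts T. \<exists>p. walk T w p u}"
  have "finite ?D" "u \<in> ?D"
    using u(1) V walk_Nil[of T u u] by auto
  then have "finite (height T r ` ?D)" "height T r ` ?D \<noteq> {}"
    by blast+
  from Max_in[OF this] obtain w where w: "w \<in> ?D" and Max: "Max (height T r ` ?D) = height T r w"
    by (rule imageE)
  have max: "height T r x \<le> height T r w" if "x \<in> ?D" for x
    unfolding Max[symmetric] using \<open>finite (height T r ` ?D)\<close> imageI[OF that] by (rule Max_ge)
  obtain p where p: "walk T w p u"
    using w by blast
  have rw: "walk T w (root_path T r w) r"
    using walk_root_path[OF tree] w by blast
  have "children T w = {}"
  proof (rule ccontr)
    assume "children T w \<noteq> {}"
    then obtain x where x: "(x, w) \<in> parcs T"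
      by (auto simp: children_def)
    then have *: "walk T x ((x, w) # p) u" "walk T x ((x, w) # root_path T r w) r"
      using p rw by (simp_all add: walk_Cons[OF wf])
    have "x \<in> ?D"
      using walk_start[OF *(1)] *(1) by blast
    from max[OF this] walk_to_root_unique[OF tree *(2)] show False
      by (simp add: height_def)
  qed
  with sorted w have s: "sorted_wrt (>) (pawalk_verts w (root_path T r w))"
    by blast
  have v: "walk T v (root_path T r v) r"
    using walk_root_path[OF tree u(2)] .
  then have "walk T u ((u, v) # root_path T r v) r"
    using uv by (simp add: walk_Cons[OF wf])
  \<comment> \<open>The walk down from \<open>w\<close> to \<open>u\<close> in the order of the
    arcs, continued by the arc and the root path of \<open>v\<close>, ends in the root; by
    uniqueness it is the root path of \<open>w\<close>.\<close>
  then have "root_path T r w = p @ (u, v) # root_path T r v"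
    by (intro walk_to_root_unique[OF tree] walk_append[OF wf p])
  with s start_in_pawalk_verts[OF v] show ?thesis
    by (simp add: pawalk_verts_append sorted_wrt_append)
qed

lemma increasing_tree_parent_function:
  assumes T: "(T, r) \<in> increasing_rooted_trees n"
  obtains f where "f \<in> forests {1..n} (Suc 0)" and "T = parent_digraph n f" and "r = 1"
proof -
  have tree: "rooted_tree T r" and wf: "pair_wf_digraph T" and V: "pverts T = {1..n}"
    and r: "r \<in> {1..n}"
    using T by (auto simp: increasing_rooted_trees_def rooted_tree_def)
  note unique = walk_to_root_unique[OF tree]
  have arc_path: "root_path T r v = (v, w) # root_path T r w" if "(v, w) \<in> parcs T" for v w
  proof (rule unique)
    show "walk T v ((v, w) # root_path T r w) r"
      using that walk_root_path[OF tree pair_wf_digraph.in_arcsD2[OF wf that]]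
      by (simp add: walk_Cons[OF wf])
  qed
  have root_path_r: "root_path T r r = []"
    using r V by (intro unique) (simp add: walk_Nil)
  \<comment> \<open>The parent is the head of the first arc on the root path. The root has an empty
    root path and receives the default 0.\<close>
  define f where "f v = (if v \<in> {1..n} - {r} then snd (hd (root_path T r v)) else 0)" for v
  \<comment> \<open>An arc followed by the root path of its head is a walk to the root, hence the
    root path of its tail. So every vertex has at most one outgoing arc, and the root has
    none.\<close>
  have arc: "(v, w) \<in> parcs T \<longleftrightarrow> v \<in> {1..n} - {r} \<and> w = f v" for v w
  proof
    assume vw: "(v, w) \<in> parcs T"
    have "v \<noteq> r"
      using arc_path[OF vw] root_path_r by auto
    moreover have "v \<in> {1..n}"
      using pair_wf_digraph.in_arcsD1[OF wf vw] V by simp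
    ultimately show "v \<in> {1..n} - {r} \<and> w = f v"
      using arc_path[OF vw] by (simp add: f_def)
  next
    assume vw: "v \<in> {1..n} - {r} \<and> w = f v"
    then have walk: "walk T v (root_path T r v) r"
      using walk_root_path[OF tree] V by blast
    moreover have "root_path T r v \<noteq> []"
      using walk vw walk_Nil[of T v r] by auto
    then obtain e p where "root_path T r v = e # p"
      by (cases "root_path T r v") auto
    ultimately show "(v, w) \<in> parcs T"
      using vw by (cases e) (auto simp: walk_Cons[OF wf] f_def)
  qed
  have f: "f v < v \<and> f v \<in> {1..n}" if "v \<in> {1..n} - {r}" for v
  proof -
    have vf: "(v, f v) \<in> parcs T"
      using arc that by simp
    show ?thesis
      using increasing_arc[OF T vf] pair_wf_digraph.in_arcsD2[OF wf vf] V by simp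
  qed
  have f0: "f v = 0" if "v \<notin> {1..n} - {r}" for v
    unfolding f_def using that by (rule if_not_P)
  have "r = 1"
  proof (rule ccontr)
    assume "r \<noteq> 1"
    then have "1 \<in> {1..n} - {r}"
      using r by auto
    from f[OF this] show False by auto
  qed
  have "f v = 0 \<longleftrightarrow> v = 1" if "v \<in> {1..n}" for v
  proof (cases "v = r")
    case True
    with f0[of v] \<open>r = 1\<close> show ?thesis by simp
  next
    case False
    with f[of v] that \<open>r = 1\<close> show ?thesis by auto
  qed
  then have "{v \<in> {1..n}. f v = 0} = {1}"
    using r \<open>r = 1\<close> by auto
  then have card: "card {v \<in> {1..n}. f v = 0} = Suc 0"
    by simp
  have "f v < v \<and> f v \<in> insert 0 {1..n}" if "v \<in> {1..n}" for v
    using f[of v] f0[of v] that by (cases "v = r") auto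
  moreover have "f v = 0" if "v \<notin> {1..n}" for v
    using f0[of v] that by blast
  ultimately have "f \<in> forests {1..n} (Suc 0)"
    unfolding forests_def using card by blast
  moreover have "parcs T = (\<lambda>v. (v, f v)) ` {2..n}"
    using arc \<open>r = 1\<close> by (auto simp: image_iff)
  then have "T = parent_digraph n f"
    using V by (simp add: parent_digraph_def)
  ultimately show ?thesis
    using that \<open>r = 1\<close> by blast
qed

lemma forest_poly_tree_polynomial:
  fixes \<phi> :: "nat \<Rightarrow> 'a::comm_ring_1"
  assumes n: "n \<ge> 1"
  shows "forest_poly \<phi> n (Suc 0) = monom 1 n * tree_polynomial \<phi> n"
proof -
  let ?w = "\<lambda>(T, r). monom (\<Prod>v\<in>{1..n}. \<phi> (card (children T v))) (path_length T r)"
  have "bij_betw (\<lambda>f. (parent_digraph n f, 1)) (forests {1..n} (Suc 0)) (increasing_rooted_trees n)"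
    unfolding bij_betw_def
  proof
    show "inj_on (\<lambda>f. (parent_digraph n f, 1)) (forests {1..n} (Suc 0))"
    proof (rule inj_onI, rule ext)
      fix f g v
      assume f: "f \<in> forests {1..n} (Suc 0)" and g: "g \<in> forests {1..n} (Suc 0)"
        and "(parent_digraph n f, 1) = (parent_digraph n g, 1)"
      then have "(\<lambda>v. (v, f v)) ` {2..n} = (\<lambda>v. (v, g v)) ` {2..n}"
        by (simp add: parent_digraph_def)
      then have "f v = g v" if "v \<in> {2..n}"
        using that by blast
      \<comment> \<open>The arcs do not record these values, but both functions vanish
        there.\<close>
      moreover have "f v = g v" if "v \<notin> {2..n}"
        using parent_eq_0_iff[OF n f, of v] parent_eq_0_iff[OF n g, of v] that by simp
      ultimately show "f v = g v"
        by blast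
    qed
    show "(\<lambda>f. (parent_digraph n f, 1)) ` forests {1..n} (Suc 0) = increasing_rooted_trees n"
    proof
      show "(\<lambda>f. (parent_digraph n f, 1)) ` forests {1..n} (Suc 0) \<subseteq> increasing_rooted_trees n"
        using parent_digraph_increasing[OF n] by blast
      show "increasing_rooted_trees n \<subseteq> (\<lambda>f. (parent_digraph n f, 1)) ` forests {1..n} (Suc 0)"
      proof
        fix X assume "X \<in> increasing_rooted_trees n"
        then obtain f where "f \<in> forests {1..n} (Suc 0)" "X = (parent_digraph n f, 1)"
          by (cases X) (metis increasing_tree_parent_function)
        then show "X \<in> (\<lambda>f. (parent_digraph n f, 1)) ` forests {1..n} (Suc 0)"
          by blast
      qed
    qed
  qed
  then have "tree_polynomial \<phi> n = (\<Sum>f\<in>forests {1..n} (Suc 0). ?w (parent_digraph n f, 1))"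
    unfolding tree_polynomial_def by (rule sum.reindex_bij_betw[symmetric])
  also have "monom 1 n * \<dots> = forest_poly \<phi> n (Suc 0)"
    unfolding forest_poly_def forest_sum_def sum_distrib_left
    by (intro sum.cong) (simp_all only: forest_weight_parent_digraph[OF n] prod.case)
  finally show ?thesis by simp
qed

section \<open>Exponential generating functions\<close>

lemma rat_embedding_of_nat:
  assumes "rat_embedding \<iota>"
  shows "\<iota> (of_nat n) = of_nat n"
proof (induction n)
  case 0
  have "\<iota> (0 + 0) = \<iota> 0 + \<iota> 0"
    using assms unfolding rat_embedding_def by blast
  then show ?case by simp
qed (use assms in \<open>auto simp: rat_embedding_def\<close>)

lemma rat_embedding_mult_of_nat:
  assumes "rat_embedding \<iota>"
  shows "\<iota> (of_nat n * x) = of_nat n * \<iota> x"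
  using assms rat_embedding_of_nat[OF assms] by (simp add: rat_embedding_def)

lemma rat_embedding_inverse_fact:
  assumes "rat_embedding \<iota>"
  shows "\<iota> (1 / fact n) * of_nat (fact n) = 1"
proof -
  have "of_nat (fact n) * \<iota> (1 / fact n) = \<iota> (of_nat (fact n) * (1 / fact n))"
    by (simp only: rat_embedding_mult_of_nat[OF assms])
  also have "\<dots> = 1"
    using assms by (simp add: rat_embedding_def)
  finally show ?thesis by (simp add: mult.commute)
qed

text \<open>Positive integers are units, with inverses in the image of the rationals; that is what
  permits cancellation in a ring with zero divisors.\<close>

lemma rat_embedding_cancel_of_nat:
  assumes "rat_embedding (\<iota> :: rat \<Rightarrow> 'a::comm_ring_1)"
    and "of_nat (Suc n) * x = of_nat (Suc n) * (y :: 'a)"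
  shows "x = y"
proof -
  have "\<iota> (1 / of_nat (Suc n)) * of_nat (Suc n) = 1"
    using rat_embedding_mult_of_nat[OF assms(1), of "Suc n" "1 / of_nat (Suc n)"] assms(1)
    by (simp add: rat_embedding_def mult.commute del: of_nat_Suc)
  then show ?thesis
    using arg_cong[OF assms(2), of "\<lambda>z. \<iota> (1 / of_nat (Suc n)) * z"]
    by (simp add: mult.assoc[symmetric] del: of_nat_Suc)
qed

text \<open>Carries the embedding over to constant polynomials, so the facts on \<open>egf\<close>
  apply with coefficients in the polynomial ring.\<close>

lemma rat_embedding_pCons:
  assumes "rat_embedding \<iota>"
  shows "rat_embedding (\<lambda>x. [:\<iota> x:])"
  using assms by (auto simp: rat_embedding_def inj_def one_pCons)

lemma fps_deriv_egf:
  assumes "rat_embedding \<iota>"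
  shows "fps_deriv (egf \<iota> a) = egf \<iota> (\<lambda>n. a (Suc n))"
proof (rule fps_ext)
  fix n
  have "of_nat (Suc n) * \<iota> (1 / fact (Suc n)) = \<iota> (of_nat (Suc n) * (1 / fact (Suc n)))"
    by (rule rat_embedding_mult_of_nat[OF assms, symmetric])
  also have "of_nat (Suc n) * (1 / fact (Suc n)) = (1 / fact n :: rat)"
    by (simp add: divide_simps del: of_nat_Suc)
  finally show "fps_deriv (egf \<iota> a) $ n = egf \<iota> (\<lambda>n. a (Suc n)) $ n"
    by (simp add: egf_def mult.assoc[symmetric] del: of_nat_Suc fact_Suc)
qed

lemma egf_mult:
  assumes "rat_embedding \<iota>"
  shows "egf \<iota> a * egf \<iota> b = egf \<iota> (\<lambda>n. \<Sum>j\<le>n. of_nat (n choose j) * (a j * b (n - j)))"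
proof (rule fps_ext)
  fix n
  have "\<iota> (1 / fact j) * a j * (\<iota> (1 / fact (n - j)) * b (n - j)) =
      \<iota> (1 / fact n) * (of_nat (n choose j) * (a j * b (n - j)))" if "j \<le> n" for j
  proof -
    have "\<iota> (1 / fact j) * \<iota> (1 / fact (n - j)) = \<iota> (1 / fact j * (1 / fact (n - j)))"
      using assms unfolding rat_embedding_def by metis
    also have "1 / fact j * (1 / fact (n - j)) = of_nat (n choose j) * (1 / fact n :: rat)"
      using that by (simp add: binomial_fact)
    also have "\<iota> \<dots> = of_nat (n choose j) * \<iota> (1 / fact n)"
      by (rule rat_embedding_mult_of_nat[OF assms])
    finally show ?thesis
      by (metis (no_types, lifting) mult.assoc mult.commute)
  qed
  then show "(egf \<iota> a * egf \<iota> b) $ n =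
      egf \<iota> (\<lambda>n. \<Sum>j\<le>n. of_nat (n choose j) * (a j * b (n - j))) $ n"
    by (simp add: egf_def fps_mult_nth sum_distrib_left atLeast0AtMost)
qed

lemma fps_eqI_deriv:
  assumes "rat_embedding (\<iota> :: rat \<Rightarrow> 'a::comm_ring_1)"
    and "fps_deriv f = fps_deriv (g :: 'a fps)" and "f $ 0 = g $ 0"
  shows "f = g"
proof (rule fps_ext)
  fix n
  show "f $ n = g $ n"
  proof (cases n)
    case (Suc m)
    have "fps_deriv f $ m = fps_deriv g $ m"
      using assms(2) by simp
    then show ?thesis
      using rat_embedding_cancel_of_nat[OF assms(1)] Suc by (simp del: of_nat_Suc)
  qed (use assms(3) in simp)
qed

text \<open>By induction both sides have the same derivative, (k+1) G_1' G_1^k at exponent k+1, and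
  both constant terms vanish there.\<close>

lemma divided_power_eq:
  fixes G :: "nat \<Rightarrow> 'a::comm_ring_1 fps"
  assumes \<iota>: "rat_embedding (\<iota> :: rat \<Rightarrow> 'a)"
    and "G 0 = 1" and "\<And>k. G (Suc k) $ 0 = 0"
    and deriv: "\<And>k. fps_deriv (G (Suc k)) = fps_deriv (G (Suc 0)) * G k"
  shows "G (Suc 0) ^ k = of_nat (fact k) * G k"
proof (induction k)
  case (Suc k)
  have "fps_deriv (G (Suc 0) ^ Suc k) = of_nat (Suc k) * fps_deriv (G (Suc 0)) * G (Suc 0) ^ k"
    by (simp only: fps_deriv_power' diff_Suc_1)
  also have "\<dots> = of_nat (fact (Suc k)) * fps_deriv (G (Suc k))"
    by (simp only: Suc deriv[of k] fact_Suc of_nat_mult of_nat_id mult_ac)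
  also have "\<dots> = fps_deriv (of_nat (fact (Suc k)) * G (Suc k))"
    by (simp only: fps_deriv_mult fps_deriv_of_nat mult_zero_left add_0_right)
  finally show ?case
    by (rule fps_eqI_deriv[OF \<iota>]) (simp add: assms(3))
qed (use assms(2) in simp)

text \<open>Multiplication by q^n only shifts the coefficients, so it is injective over every
  commutative ring.\<close>

lemma monom_mult_cancel:
  fixes p q :: "'a::comm_ring_1 poly"
  assumes "monom 1 n * p = monom 1 n * q"
  shows "p = q"
proof (rule poly_eqI)
  fix i
  have "coeff (monom 1 n * p) (n + i) = coeff (monom 1 n * q) (n + i)"
    using assms by simp
  then show "coeff p i = coeff q i"
    by (simp add: coeff_monom_mult)
qed

theorem theorem1:
  fixes \<iota> :: "rat \<Rightarrow> 'a::comm_ring_1"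
    and \<phi> :: "nat \<Rightarrow> 'a"
  assumes "rat_embedding \<iota>"
    and "\<phi> 0 \<noteq> 0"
  shows "fps_deriv (tree_egf \<iota> \<phi>) =
           fps_compose (fps_const_poly (egf \<iota> \<phi>))
             (fps_compose (tree_egf \<iota> \<phi>) (fps_const [:0, 1:] * fps_X))
         \<and> fps_nth (tree_egf \<iota> \<phi>) 0 = 0"
proof
  define C where "C x = [:\<iota> x:]" for x
  have C: "rat_embedding C"
    unfolding C_def using assms(1) by (rule rat_embedding_pCons)
  define p where "p n = (if n = 0 then 0 else tree_polynomial \<phi> n)" for n
  have P: "tree_egf \<iota> \<phi> = egf C p"
    unfolding tree_egf_def C_def[abs_def] p_def[abs_def] ..
  show "tree_egf \<iota> \<phi> $ 0 = 0"
    by (simp add: P egf_def p_def)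
  define G where "G k = egf C (\<lambda>n. forest_poly \<phi> n k)" for k
  \<comment> \<open>Substituting tq for t multiplies the n-th coefficient by q^n, exactly the excess
    of depth over height. For n = 0 both sides vanish: \<open>p 0\<close> is 0, and the empty forest
    has no root.\<close>
  have "egf C p oo (fps_const [:0, 1:] * fps_X) = G (Suc 0)"
  proof (rule fps_ext)
    fix n
    have "[:0, 1:] ^ n = monom (1 :: 'a) n"
      by (simp add: monom_altdef)
    then have "[:0, 1:] ^ n * p n = forest_poly \<phi> n (Suc 0)"
      by (simp add: p_def forest_poly_0 forest_poly_tree_polynomial)
    then show "(egf C p oo (fps_const [:0, 1:] * fps_X)) $ n = G (Suc 0) $ n"
      unfolding fps_nth_compose_linear by (simp add: G_def egf_def mult.left_commute)
  qed
  moreover have "G (Suc 0) ^ k = of_nat (fact k) * G k" for k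
  proof (rule divided_power_eq[OF C])
    show "G 0 = 1"
    proof (rule fps_ext)
      fix n show "G 0 $ n = 1 $ n"
        using C by (cases n)
          (simp_all add: G_def egf_def forest_poly_0 forest_poly_no_root rat_embedding_def)
    qed
    show "G (Suc k) $ 0 = 0" for k
      by (simp add: G_def egf_def forest_poly_0)
    show "fps_deriv (G (Suc k)) = fps_deriv (G (Suc 0)) * G k" for k
      by (simp only: G_def fps_deriv_egf[OF C] egf_mult[OF C] forest_poly_component[of _ _ k])
  qed
  \<comment> \<open>The right-hand side is the coefficient of the composition, with the k-th power
    of the inner series already replaced by k! G_k.\<close>
  moreover have "fps_deriv (egf C p) $ n =
      (\<Sum>k=0..n. fps_const_poly (egf \<iota> \<phi>) $ k * (of_nat (fact k) * G k) $ n)" for n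
  proof -
    \<comment> \<open>Here q^(n+1) occurs on both sides: on the left as the excess of depth over
      height, on the right from deleting the root.\<close>
    have "monom 1 (Suc n) * p (Suc n) = forest_poly \<phi> (Suc n) (Suc 0)"
      by (simp add: p_def forest_poly_tree_polynomial)
    also have "\<dots> = monom 1 (Suc n) * (\<Sum>k\<le>n. [:\<phi> k:] * forest_poly \<phi> n k)"
    proof -
      have "monom (\<phi> k) (Suc n) = monom 1 (Suc n) * [:\<phi> k:]" for k
        by (simp add: smult_monom mult.commute)
      then show ?thesis
        by (simp only: forest_poly_root sum_distrib_left mult.assoc)
    qed
    finally have p: "p (Suc n) = (\<Sum>k\<le>n. [:\<phi> k:] * forest_poly \<phi> n k)"
      by (rule monom_mult_cancel)
    \<comment> \<open>The 1/k! belonging to \<open>\<phi> k\<close> cancels the k! of the power,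
      leaving only the factor 1/n! of the outer series.\<close>
    have "fps_const_poly (egf \<iota> \<phi>) $ k * (of_nat (fact k) * G k) $ n =
        C (1 / fact n) * ([:\<phi> k:] * forest_poly \<phi> n k)" for k
    proof -
      have "fps_const_poly (egf \<iota> \<phi>) $ k = C (1 / fact k) * [:\<phi> k:]"
        by (simp add: fps_const_poly_def egf_def C_def)
      moreover have "(of_nat (fact k) * G k) $ n = of_nat (fact k) * G k $ n"
        by (simp only: fps_of_nat[symmetric] fps_mult_left_const_nth)
      ultimately have "fps_const_poly (egf \<iota> \<phi>) $ k * (of_nat (fact k) * G k) $ n =
          (C (1 / fact k) * of_nat (fact k)) * ([:\<phi> k:] * G k $ n)"
        by (simp only: mult_ac)
      also have "\<dots> = [:\<phi> k:] * (C (1 / fact n) * forest_poly \<phi> n k)"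
        by (simp only: rat_embedding_inverse_fact[OF C] mult_1) (simp only: G_def egf_def fps_nth_Abs_fps)
      finally show ?thesis
        by (simp only: mult_ac)
    qed
    moreover have "fps_deriv (egf C p) $ n = C (1 / fact n) * p (Suc n)"
      by (simp only: fps_deriv_egf[OF C]) (simp only: egf_def fps_nth_Abs_fps)
    ultimately show ?thesis
      by (simp only: p sum_distrib_left atLeast0AtMost)
  qed
  ultimately show "fps_deriv (tree_egf \<iota> \<phi>) = fps_const_poly (egf \<iota> \<phi>) oo
      (tree_egf \<iota> \<phi> oo (fps_const [:0, 1:] * fps_X))"
    unfolding P by (intro fps_ext) (simp only: fps_compose_nth)
qed

end
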